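(* Let $H\le G$ act on $X=\Gamma\backslash G$, and suppose that $(G,H,\Gamma)$ is a tempered triple and that $d_H^-=d_H^+=d_H$. Then for any family $\{A_t\}$ of shrinking targets which is stable under small perturbations by $H$, the critical exponent satisfies $\alpha_{H,A}=d_H$.
   Context: Notation: $F(t)\ll G(t)$ means $F(t)\le cG(t)$ for some constant $c>0$ (subscripts indicate what $c$ depends on), and $F(t)\asymp G(t)$ means $c^{-1}F(t)\le G(t)\le cF(t)$ for some constant $c>1$. $G$ is a locally compact group, $\Gamma$ a lattice in $G$, $H$ a unimodular subgroup of $G$ with Haar measure $m$, acting ergodically on $X=\Gamma\backslash G$ on the right, and $\mu$ is the $G$-invariant probability measure on $X$. A norm $\|\cdot\|$ on $H$ is fixed and $H_t=\{h\in H:\|h\|\le t\}$. Bounded subsets of $H$ are bounded with respect to this norm. Growth exponents: $d_H^-\le d_H^+$ are such that for any $\epsilon>0$, $t^{d_H^--\epsilon}\ll_\epsilon m(H_t)\ll_\epsilon t^{d_H^++\epsilon}$. Tempered triple: for every $0<\kappa<1/2$ and any $f\in L^2(X)$, $\|\pi_t f-\int_X f\,d\mu\|_2\ll_\kappa m(H_t)^{-\kappa}\|f\|_2$, where $\pi_t(f)(x)=\frac{1}{m(H_t)}\int_{H_t}f(xh)\,dm(h)$. Family of shrinking targets: a decreasing family $\{A_t\}_{t\ge1}$ of measurable subsets of $X$ with $\mu(A_t)\asymp 1/t$. It is stable under small perturbations by $H$ if $\mu(A_t)\asymp\mu(A_tH_1)$, where $A_tH_1=\{xh:x\in A_t,\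 h\in H_1\}$. Critical exponent: for $x\in X$, $\alpha_{H,A}(x)$ is the infimum over all $\eta\ge 0$ such that $\{h\in H: xh\in A_{\|h\|^\eta}\}$ is bounded, if such an exponent exists; $\alpha_{H,A}$ denotes its almost everywhere constant value. *)

theory Defs
  imports "HOL-Algebra.Coset" "HOL-Probability.Probability"
begin

text \<open>The statement quantifies over a group, a subgroup, a quotient and measures on them, so
  everything is carrier-based: groups are those of HOL-Algebra and topologies are abstract
  topologies on the carriers.\<close>

definition dominated :: "(real \<Rightarrow> real) \<Rightarrow> (real \<Rightarrow> real) \<Rightarrow> bool"  (infix \<open>\<lless>\<close> 50) where
  "F \<lless> G \<longleftrightarrow> (\<exists>c>0. \<forall>t\<ge>1. F t \<le> c * G t)"

definition comparable :: "(real \<Rightarrow> real) \<Rightarrow> (real \<Rightarrow> real) \<Rightarrow> bool"  (infix \<open>\<asymp>\<close> 50) where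
  "F \<asymp> G \<longleftrightarrow> (\<exists>c>1. \<forall>t\<ge>1. inverse c * F t \<le> G t \<and> G t \<le> c * F t)"

definition locally_compact_group :: "('a, 'r) monoid_scheme \<Rightarrow> 'a topology \<Rightarrow> bool" where
  "locally_compact_group G T \<longleftrightarrow>
     group G \<and> topspace T = carrier G \<and>
     continuous_map (prod_topology T T) T (\<lambda>(x, y). x \<otimes>\<^bsub>G\<^esub> y) \<and>
     continuous_map T T (\<lambda>x. inv\<^bsub>G\<^esub> x) \<and>
     Hausdorff_space T \<and> locally_compact_space T"

abbreviation subgrp :: "('a, 'r) monoid_scheme \<Rightarrow> 'a set \<Rightarrow> ('a, 'r) monoid_scheme" where
  "subgrp G H \<equiv> G\<lparr>carrier := H\<rparr>"

definition radon_measure :: "'a topology \<Rightarrow> 'a measure \<Rightarrow> bool" where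
  "radon_measure T M \<longleftrightarrow>
     space M = topspace T \<and> sets M = sigma_sets (topspace T) {U. openin T U} \<and>
     (\<forall>K. compactin T K \<longrightarrow> emeasure M K < \<infinity>) \<and>
     (\<forall>A\<in>sets M. emeasure M A = (INF U\<in>{U. openin T U \<and> A \<subseteq> U}. emeasure M U)) \<and>
     (\<forall>U. openin T U \<longrightarrow>
        emeasure M U = (SUP K\<in>{K. compactin T K \<and> K \<in> sets M \<and> K \<subseteq> U}. emeasure M K))"

definition haar_measure :: "('a, 'r) monoid_scheme \<Rightarrow> 'a topology \<Rightarrow> 'a measure \<Rightarrow> bool" where
  "haar_measure G T m \<longleftrightarrow>
     radon_measure T m \<and> emeasure m (space m) \<noteq> 0 \<and>
     (\<forall>g\<in>carrier G. \<forall>A\<in>sets m. emeasure m (g <#\<^bsub>G\<^esub> A) = emeasure m A)"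

definition unimodular :: "('a, 'r) monoid_scheme \<Rightarrow> 'a topology \<Rightarrow> bool" where
  "unimodular G T \<longleftrightarrow>
     (\<forall>m. haar_measure G T m \<longrightarrow>
        (\<forall>g\<in>carrier G. \<forall>A\<in>sets m. emeasure m (A #>\<^bsub>G\<^esub> g) = emeasure m A))"

text \<open>The space of right cosets \<open>rcosets\<^bsub>G\<^esub> \<Gamma>\<close>, with the quotient topology; an
  element \<open>h\<close> acts on it from the right by \<open>x \<mapsto> x #>\<^bsub>G\<^esub> h\<close>.\<close>

definition coset_topology ::
    "('a, 'r) monoid_scheme \<Rightarrow> 'a topology \<Rightarrow> 'a set \<Rightarrow> 'a set topology" where
  "coset_topology G T \<Gamma> =
     topology (\<lambda>U. U \<subseteq> rcosets\<^bsub>G\<^esub> \<Gamma> \<and> openin T {g \<in> carrier G. \<Gamma> #>\<^bsub>G\<^esub> g \<in> U})"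

lemma openin_coset_topology:
  assumes T: "topspace T = carrier G"
  shows "openin (coset_topology G T \<Gamma>) U \<longleftrightarrow>
     U \<subseteq> rcosets\<^bsub>G\<^esub> \<Gamma> \<and> openin T {g \<in> carrier G. \<Gamma> #>\<^bsub>G\<^esub> g \<in> U}"
proof -
  let ?P = "\<lambda>U. U \<subseteq> rcosets\<^bsub>G\<^esub> \<Gamma> \<and> openin T {g \<in> carrier G. \<Gamma> #>\<^bsub>G\<^esub> g \<in> U}"
  have "istopology ?P"
    unfolding istopology_def
  proof (rule conjI; intro allI impI)
    fix S S' assume S: "?P S" and S': "?P S'"
    have "{g \<in> carrier G. \<Gamma> #>\<^bsub>G\<^esub> g \<in> S \<inter> S'} =
        {g \<in> carrier G. \<Gamma> #>\<^bsub>G\<^esub> g \<in> S} \<inter> {g \<in> carrier G. \<Gamma> #>\<^bsub>G\<^esub> g \<in> S'}"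
      by blast
    moreover have "openin T ({g \<in> carrier G. \<Gamma> #>\<^bsub>G\<^esub> g \<in> S} \<inter> {g \<in> carrier G. \<Gamma> #>\<^bsub>G\<^esub> g \<in> S'})"
      using conjunct2[OF S] conjunct2[OF S'] by (rule openin_Int)
    moreover have "S \<inter> S' \<subseteq> rcosets\<^bsub>G\<^esub> \<Gamma>"
      using conjunct1[OF S] by (rule le_infI1)
    ultimately show "?P (S \<inter> S')"
      by (simp only:)
  next
    fix \<K> assume K: "\<forall>S\<in>\<K>. ?P S"
    have "{g \<in> carrier G. \<Gamma> #>\<^bsub>G\<^esub> g \<in> \<Union>\<K>} =
        (\<Union>S\<in>\<K>. {g \<in> carrier G. \<Gamma> #>\<^bsub>G\<^esub> g \<in> S})"
      by blast
    moreover have "openin T (\<Union>S\<in>\<K>. {g \<in> carrier G. \<Gamma> #>\<^bsub>G\<^esub> g \<in> S})"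
      by (rule openin_Union) (use K in blast)
    moreover have "\<Union>\<K> \<subseteq> rcosets\<^bsub>G\<^esub> \<Gamma>"
      by (rule Union_least) (use K in blast)
    ultimately show "?P (\<Union>\<K>)"
      by (simp only:)
  qed
  then show ?thesis
    by (simp add: coset_topology_def topology_inverse')
qed

lemma topspace_coset_topology:
  assumes "topspace T = carrier G"
  shows "topspace (coset_topology G T \<Gamma>) = rcosets\<^bsub>G\<^esub> \<Gamma>"
proof -
  have "{g \<in> carrier G. \<Gamma> #>\<^bsub>G\<^esub> g \<in> rcosets\<^bsub>G\<^esub> \<Gamma>} = topspace T"
    using assms by (auto simp: RCOSETS_def)
  then have "openin (coset_topology G T \<Gamma>) (rcosets\<^bsub>G\<^esub> \<Gamma>)"
    by (simp add: openin_coset_topology[OF assms])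
  then show ?thesis
    using openin_coset_topology[OF assms, of \<Gamma> "topspace (coset_topology G T \<Gamma>)"]
    by (intro subset_antisym openin_subset) auto
qed

definition invariant_probability ::
    "('a, 'r) monoid_scheme \<Rightarrow> 'a topology \<Rightarrow> 'a set \<Rightarrow> 'a set measure \<Rightarrow> bool" where
  "invariant_probability G T \<Gamma> \<mu> \<longleftrightarrow>
     radon_measure (coset_topology G T \<Gamma>) \<mu> \<and> prob_space \<mu> \<and>
     (\<forall>g\<in>carrier G. \<forall>A\<in>sets \<mu>. emeasure \<mu> ((\<lambda>x. x #>\<^bsub>G\<^esub> g) ` A) = emeasure \<mu> A)"

definition lattice_in :: "('a, 'r) monoid_scheme \<Rightarrow> 'a topology \<Rightarrow> 'a set \<Rightarrow> bool" where
  "lattice_in G T \<Gamma> \<longleftrightarrow>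
     subgroup \<Gamma> G \<and> subtopology T \<Gamma> = discrete_topology \<Gamma> \<and>
     (\<exists>\<mu>. invariant_probability G T \<Gamma> \<mu>)"

definition acts_ergodically ::
    "('a, 'r) monoid_scheme \<Rightarrow> 'a set \<Rightarrow> 'a set measure \<Rightarrow> bool" where
  "acts_ergodically G H \<mu> \<longleftrightarrow>
     (\<forall>A\<in>sets \<mu>. (\<forall>h\<in>H. (\<lambda>x. x #>\<^bsub>G\<^esub> h) ` A = A) \<longrightarrow>
        measure \<mu> A = 0 \<or> measure \<mu> A = 1)"

text \<open>A norm on a locally compact group, in the broad sense used for growth of norm balls. The
  last condition is common to restrictions of matrix norms (\<open>\<parallel>gh\<parallel> \<le> c \<parallel>g\<parallel> \<parallel>h\<parallel>\<close>) and to
  vector space norms and length functions (\<open>\<parallel>gh\<parallel> \<le> \<parallel>g\<parallel> + \<parallel>h\<parallel>\<close>, where \<open>c = 2\<close> works); neither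
  definiteness nor symmetry is required, as these fail for matrix norms.\<close>

definition group_norm ::
    "('a, 'r) monoid_scheme \<Rightarrow> 'a topology \<Rightarrow> ('a \<Rightarrow> real) \<Rightarrow> bool" where
  "group_norm G T N \<longleftrightarrow>
     continuous_map T euclideanreal N \<and>
     (\<forall>g\<in>carrier G. 0 \<le> N g) \<and>
     (\<exists>c. \<forall>g\<in>carrier G. \<forall>h\<in>carrier G. N (g \<otimes>\<^bsub>G\<^esub> h) \<le> c * max 1 (N g) * max 1 (N h))"

definition norm_ball :: "'a set \<Rightarrow> ('a \<Rightarrow> real) \<Rightarrow> real \<Rightarrow> 'a set" where
  "norm_ball H N t = {h \<in> H. N h \<le> t}"

definition norm_bounded :: "('a \<Rightarrow> real) \<Rightarrow> 'a set \<Rightarrow> bool" where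
  "norm_bounded N S \<longleftrightarrow> (\<exists>R. \<forall>h\<in>S. N h \<le> R)"

text \<open>The estimates hold for all \<open>t \<ge> 1\<close>. Since \<^const>\<open>measure\<close> is zero on sets of infinite
  measure, the lower bound also says that every ball of radius at least one has positive finite
  measure.\<close>

definition growth_exponents ::
    "'a set \<Rightarrow> ('a \<Rightarrow> real) \<Rightarrow> 'a measure \<Rightarrow> real \<Rightarrow> real \<Rightarrow> bool" where
  "growth_exponents H N m dminus dplus \<longleftrightarrow>
     dminus \<le> dplus \<and>
     (\<forall>\<epsilon>>0. (\<lambda>t. t powr (dminus - \<epsilon>)) \<lless> (\<lambda>t. measure m (norm_ball H N t)) \<and>
            (\<lambda>t. measure m (norm_ball H N t)) \<lless> (\<lambda>t. t powr (dplus + \<epsilon>)))"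

definition square_integrable :: "'b measure \<Rightarrow> ('b \<Rightarrow> real) \<Rightarrow> bool" where
  "square_integrable M f \<longleftrightarrow> f \<in> borel_measurable M \<and> integrable M (\<lambda>x. (f x)\<^sup>2)"

definition l2_norm :: "'b measure \<Rightarrow> ('b \<Rightarrow> real) \<Rightarrow> real" where
  "l2_norm M f = sqrt (LINT x|M. (f x)\<^sup>2)"

definition ball_average ::
    "('a, 'r) monoid_scheme \<Rightarrow> 'a set \<Rightarrow> ('a \<Rightarrow> real) \<Rightarrow> 'a measure \<Rightarrow> real \<Rightarrow>
     ('a set \<Rightarrow> real) \<Rightarrow> 'a set \<Rightarrow> real" where
  "ball_average G H N m t f x =
     (1 / measure m (norm_ball H N t)) * (LINT h:norm_ball H N t|m. f (x #>\<^bsub>G\<^esub> h))"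

definition tempered ::
    "('a, 'r) monoid_scheme \<Rightarrow> 'a set \<Rightarrow> ('a \<Rightarrow> real) \<Rightarrow> 'a measure \<Rightarrow> 'a set measure \<Rightarrow> bool" where
  "tempered G H N m \<mu> \<longleftrightarrow>
     (\<forall>\<kappa>. 0 < \<kappa> \<and> \<kappa> < 1/2 \<longrightarrow>
        (\<exists>C>0. \<forall>f. square_integrable \<mu> f \<longrightarrow> (\<forall>t\<ge>1.
           square_integrable \<mu> (\<lambda>x. ball_average G H N m t f x - (LINT y|\<mu>. f y)) \<and>
           l2_norm \<mu> (\<lambda>x. ball_average G H N m t f x - (LINT y|\<mu>. f y))
             \<le> C * measure m (norm_ball H N t) powr (- \<kappa>) * l2_norm \<mu> f)))"

definition shrinking_targets :: "'b measure \<Rightarrow> (real \<Rightarrow> 'b set) \<Rightarrow> bool" where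
  "shrinking_targets \<mu> A \<longleftrightarrow>
     (\<forall>t\<ge>1. A t \<in> sets \<mu>) \<and>
     (\<forall>s t. 1 \<le> s \<and> s \<le> t \<longrightarrow> A t \<subseteq> A s) \<and>
     (\<lambda>t. measure \<mu> (A t)) \<asymp> (\<lambda>t. 1 / t)"

text \<open>The set \<open>A\<^sub>t H\<^sub>1\<close> need not be Borel; the outer measure agrees with \<open>\<mu>\<close> (and with its
  completion) whenever it is measurable.\<close>

definition stable_under_perturbations ::
    "('a, 'r) monoid_scheme \<Rightarrow> 'a set \<Rightarrow> ('a \<Rightarrow> real) \<Rightarrow> 'a set measure \<Rightarrow>
     (real \<Rightarrow> 'a set set) \<Rightarrow> bool" where
  "stable_under_perturbations G H N \<mu> A \<longleftrightarrow>
     (\<lambda>t. measure \<mu> (A t)) \<asymp>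
     (\<lambda>t. enn2real (outer_measure_of \<mu> {x #>\<^bsub>G\<^esub> h | x h. x \<in> A t \<and> h \<in> norm_ball H N 1}))"

text \<open>The infimum over the empty set is \<open>\<infinity>\<close>, so a finite value entails that an admissible
  exponent exists. The family \<open>A\<close> is indexed by reals \<open>t \<ge> 1\<close>, hence the restriction to
  \<open>N h \<ge> 1\<close>, which does not affect boundedness.\<close>

definition critical_exponent ::
    "('a, 'r) monoid_scheme \<Rightarrow> 'a set \<Rightarrow> ('a \<Rightarrow> real) \<Rightarrow> (real \<Rightarrow> 'a set set) \<Rightarrow> 'a set \<Rightarrow> ereal" where
  "critical_exponent G H N A x =
     Inf (ereal ` {\<eta>. 0 \<le> \<eta> \<and>
       norm_bounded N {h \<in> H. 1 \<le> N h \<and> x #>\<^bsub>G\<^esub> h \<in> A (N h powr \<eta>)}})"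

end

theory Submission
  imports Defs
begin

text \<open>Temperedness and Chebyshev's inequality bound the measure of the set of points at which the
  ball average of an indicator deviates from its mean; along radii \<open>t = 2 ^ k\<close> the bounds are
  summable, and Borel--Cantelli applies. If \<open>\<eta> < d\<close>, then for almost every \<open>x\<close> and all large
  dyadic \<open>t\<close> the elements of \<open>H\<^sub>t\<close> sending \<open>x\<close> into the target with index \<open>t powr \<eta>\<close> have Haar
  measure comparable to \<open>t\<^sup>-\<^sup>\<eta>\<close> times that of \<open>H\<^sub>t\<close>, which tends to infinity, so they cannot
  stay in a fixed ball. If \<open>\<eta> > d\<close>, a single visit produces a set of visits to the thickened
  target of Haar measure at least that of \<open>H\<^sub>1\<close>, far above the mean value. Using temperedness here
  instead of Markov's inequality avoids Fubini's theorem, for which the Borel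
  \<open>\<sigma>\<close>-algebra on the product of non-second-countable spaces would be an obstacle.\<close>

section \<open>Powers along dyadic sequences, Chebyshev and Borel--Cantelli\<close>

lemma summable_powr_dyadic:
  fixes r :: real
  assumes "0 < r"
  shows "summable (\<lambda>k. (2 ^ k) powr (- r))"
proof -
  have "(2 ^ k) powr (- r) = (2 powr (- r)) ^ k" for k :: nat
    by (simp add: powr_powr powr_realpow[symmetric] mult.commute)
  moreover have "2 powr (- r) < 1"
    using assms by (simp add: powr_less_one)
  ultimately show ?thesis
    by (simp add: summable_geometric)
qed

lemma eventually_dyadic_powr_less:
  fixes a b p q :: real
  assumes "p < q" "0 < b"
  shows "eventually (\<lambda>k. a * (2 ^ k) powr p < b * (2 ^ k) powr q) sequentially"
proof -
  have "(\<lambda>k. a * (2 ^ k) powr (- (q - p))) \<longlonglongrightarrow> a * 0"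
    using assms by (intro tendsto_mult_left summable_LIMSEQ_zero summable_powr_dyadic) simp
  then have "eventually (\<lambda>k. a * (2 ^ k) powr (- (q - p)) < b) sequentially"
    using assms by (simp add: order_tendstoD(2))
  then show ?thesis
  proof eventually_elim
    case (elim k)
    have "a * (2 ^ k) powr (- (q - p)) * (2 ^ k) powr q < b * (2 ^ k) powr q"
      using elim by (intro mult_strict_right_mono) auto
    moreover have "(2 ^ k) powr (- (q - p)) * (2 ^ k) powr q = (2 ^ k :: real) powr p"
      by (simp add: powr_add[symmetric])
    ultimately show ?case
      by (simp only: mult.assoc)
  qed
qed

text \<open>Chebyshev's inequality, obtained from Markov's inequality for the square of
  \<open>f\<close>.\<close>

lemma measure_abs_ge_l2_norm:
  assumes "finite_measure M" "square_integrable M f" "0 < \<delta>"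
  shows "{x \<in> space M. \<delta> \<le> \<bar>f x\<bar>} \<in> sets M"
    and "measure M {x \<in> space M. \<delta> \<le> \<bar>f x\<bar>} \<le> (l2_norm M f)\<^sup>2 / \<delta>\<^sup>2"
proof -
  have [measurable]: "f \<in> borel_measurable M" and int: "integrable M (\<lambda>x. (f x)\<^sup>2)"
    using assms by (auto simp: square_integrable_def)
  show "{x \<in> space M. \<delta> \<le> \<bar>f x\<bar>} \<in> sets M"
    by measurable
  have eq: "{x \<in> space M. \<delta> \<le> \<bar>f x\<bar>} = {x \<in> space M. \<delta>\<^sup>2 \<le> (f x)\<^sup>2}"
    using assms(3) abs_le_square_iff[of \<delta>] by auto
  have "measure M {x \<in> space M. \<delta>\<^sup>2 \<le> (f x)\<^sup>2} \<le> (LINT x|M. (f x)\<^sup>2) / \<delta>\<^sup>2"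
    using assms(3) by (intro integral_Markov_inequality_measure[OF int, of "space M"]) auto
  then show "measure M {x \<in> space M. \<delta> \<le> \<bar>f x\<bar>} \<le> (l2_norm M f)\<^sup>2 / \<delta>\<^sup>2"
    by (simp add: eq l2_norm_def)
qed

lemma (in finite_measure) borel_cantelli_summable_bound:
  assumes "\<And>k. measure M (B k) \<le> g k" "\<And>k. B k \<in> sets M" "summable g"
  shows "AE x in M. eventually (\<lambda>k. x \<notin> B k) sequentially"
proof -
  have "summable (\<lambda>k. measure M (B k))"
    using assms(1) by (intro summable_comparison_test'[OF assms(3)]) simp
  then have "AE x in M. eventually (\<lambda>k. x \<in> space M - B k) sequentially"
    using assms(2) by (intro borel_cantelli_AE1) (auto simp: emeasure_eq_measure)
  then show ?thesis
    by (rule AE_mp) (auto intro!: AE_I2 elim: eventually_mono)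
qed

section \<open>The action on the coset space and measurability along orbits\<close>

locale tempered_targets =
  fixes G :: "('a, 'r) monoid_scheme" and T :: "'a topology"
    and \<Gamma> H :: "'a set" and m :: "'a measure" and \<mu> :: "'a set measure"
    and N :: "'a \<Rightarrow> real" and d :: real and A :: "real \<Rightarrow> 'a set set"
  assumes G: "locally_compact_group G T"
    and \<Gamma>: "subgroup \<Gamma> G"
    and \<mu>: "invariant_probability G T \<Gamma> \<mu>"
    and H: "subgroup H G"
    and m: "haar_measure (subgrp G H) (subtopology T H) m"
    and N: "group_norm (subgrp G H) (subtopology T H) N"
    and growth: "growth_exponents H N m d d"
    and tempered: "tempered G H N m \<mu>"
    and targets: "shrinking_targets \<mu> A"
    and stable: "stable_under_perturbations G H N \<mu> A"
begin

abbreviation V :: "real \<Rightarrow> real" where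
  "V t \<equiv> measure m (norm_ball H N t)"

sublocale group G
  using G by (simp add: locally_compact_group_def)

sublocale prob_space \<mu>
  using \<mu> by (simp add: invariant_probability_def)

lemma topspace_T: "topspace T = carrier G"
  using G by (simp add: locally_compact_group_def)

lemma H_carrier: "H \<subseteq> carrier G"
  using H by (rule subgroup.subset)

lemma \<Gamma>_carrier: "\<Gamma> \<subseteq> carrier G"
  using \<Gamma> by (rule subgroup.subset)

lemma space_m: "space m = H"
  using m H_carrier by (auto simp: haar_measure_def radon_measure_def topspace_T)

lemma sets_m: "sets m = sigma_sets H {U. openin (subtopology T H) U}"
  using m H_carrier by (auto simp: haar_measure_def radon_measure_def topspace_T Int_absorb1)

lemma space_\<mu>: "space \<mu> = rcosets\<^bsub>G\<^esub> \<Gamma>"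
  using \<mu> by (simp add: invariant_probability_def radon_measure_def topspace_coset_topology topspace_T)

lemma sets_\<mu>: "sets \<mu> = sigma_sets (rcosets\<^bsub>G\<^esub> \<Gamma>) {U. openin (coset_topology G T \<Gamma>) U}"
  using \<mu> by (simp add: invariant_probability_def radon_measure_def topspace_coset_topology topspace_T)

lemma rcosets_translate:
  assumes "x \<in> rcosets\<^bsub>G\<^esub> \<Gamma>" "h \<in> carrier G"
  shows "x #>\<^bsub>G\<^esub> h \<in> rcosets\<^bsub>G\<^esub> \<Gamma>"
  using assms \<Gamma>_carrier by (auto simp: RCOSETS_def coset_mult_assoc)

text \<open>If \<open>x\<close> is the coset of \<open>g\<close>, the orbit map is left
  multiplication by \<open>g\<close>, which is continuous on \<open>H\<close>, followed by the
  quotient map. So preimages of quotient-open sets are open in \<open>H\<close>, and these sets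
  generate the \<sigma>-algebra of \<open>\<mu>\<close>.\<close>

lemma orbit_measurable:
  assumes x: "x \<in> rcosets\<^bsub>G\<^esub> \<Gamma>" and E: "E \<in> sets \<mu>"
  shows "{h \<in> H. x #>\<^bsub>G\<^esub> h \<in> E} \<in> sets m"
proof -
  obtain g where g: "g \<in> carrier G" and xg: "x = \<Gamma> #>\<^bsub>G\<^esub> g"
    using x by (auto simp: RCOSETS_def)
  have "continuous_map (subtopology T H) T (\<lambda>h. g \<otimes>\<^bsub>G\<^esub> h)"
  proof -
    have "continuous_map T (prod_topology T T) (\<lambda>h. (g, h))"
      using g by (simp add: continuous_map_pairwise o_def topspace_T)
    moreover have "continuous_map (prod_topology T T) T (\<lambda>(x, y). x \<otimes>\<^bsub>G\<^esub> y)"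
      using G by (simp add: locally_compact_group_def)
    ultimately have "continuous_map T T (\<lambda>h. g \<otimes>\<^bsub>G\<^esub> h)"
      using continuous_map_compose by (fastforce simp: o_def)
    then show ?thesis
      by (rule continuous_map_from_subtopology)
  qed
  note cont = this
  have "(\<lambda>h. x #>\<^bsub>G\<^esub> h) \<in> measurable m (sigma (rcosets\<^bsub>G\<^esub> \<Gamma>) {U. openin (coset_topology G T \<Gamma>) U})"
  proof (rule measurable_sigma_sets)
    show "{U. openin (coset_topology G T \<Gamma>) U} \<subseteq> Pow (rcosets\<^bsub>G\<^esub> \<Gamma>)"
      by (auto simp: openin_coset_topology[OF topspace_T])
    then show "sets (sigma (rcosets\<^bsub>G\<^esub> \<Gamma>) {U. openin (coset_topology G T \<Gamma>) U}) =
        sigma_sets (rcosets\<^bsub>G\<^esub> \<Gamma>) {U. openin (coset_topology G T \<Gamma>) U}"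
      by (rule sets_measure_of)
    show "(\<lambda>h. x #>\<^bsub>G\<^esub> h) \<in> space m \<rightarrow> rcosets\<^bsub>G\<^esub> \<Gamma>"
      using H_carrier rcosets_translate[OF x] by (auto simp: space_m)
    fix U assume "U \<in> {U. openin (coset_topology G T \<Gamma>) U}"
    then have "openin T {g \<in> carrier G. \<Gamma> #>\<^bsub>G\<^esub> g \<in> U}"
      by (simp add: openin_coset_topology[OF topspace_T])
    then have "openin (subtopology T H) {h \<in> topspace (subtopology T H). g \<otimes>\<^bsub>G\<^esub> h \<in> {g \<in> carrier G. \<Gamma> #>\<^bsub>G\<^esub> g \<in> U}}"
      using cont by (rule openin_continuous_map_preimage[rotated])
    moreover have "{h \<in> topspace (subtopology T H). g \<otimes>\<^bsub>G\<^esub> h \<in> {g \<in> carrier G. \<Gamma> #>\<^bsub>G\<^esub> g \<in> U}}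
        = (\<lambda>h. x #>\<^bsub>G\<^esub> h) -` U \<inter> space m"
      using H_carrier g \<Gamma>_carrier by (auto simp: topspace_T space_m xg coset_mult_assoc)
    ultimately show "(\<lambda>h. x #>\<^bsub>G\<^esub> h) -` U \<inter> space m \<in> sets m"
      by (auto simp: sets_m)
  qed
  moreover have "sets (sigma (rcosets\<^bsub>G\<^esub> \<Gamma>) {U. openin (coset_topology G T \<Gamma>) U}) = sets \<mu>"
    unfolding sets_\<mu> by (rule sets_measure_of) (auto simp: openin_coset_topology[OF topspace_T])
  ultimately have "(\<lambda>h. x #>\<^bsub>G\<^esub> h) -` E \<inter> space m \<in> sets m"
    using E by (blast intro: measurable_sets)
  moreover have "(\<lambda>h. x #>\<^bsub>G\<^esub> h) -` E \<inter> space m = {h \<in> H. x #>\<^bsub>G\<^esub> h \<in> E}"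
    by (auto simp: space_m)
  ultimately show ?thesis
    by simp
qed

text \<open>This turns averages into proportions of visits. It covers every \<open>E\<close> and
  \<open>x\<close>: if the set of visits is not measurable, both the integral and
  \<open>measure\<close> take the default value zero.\<close>

lemma ball_average_indicator:
  "ball_average G H N m t (indicator E) x =
     measure m {h \<in> norm_ball H N t. x #>\<^bsub>G\<^esub> h \<in> E} / V t"
proof -
  have "(LINT h:norm_ball H N t|m. indicator E (x #>\<^bsub>G\<^esub> h)) =
      (LINT h|m. indicator {h \<in> norm_ball H N t. x #>\<^bsub>G\<^esub> h \<in> E} h)"
    unfolding set_lebesgue_integral_def
    by (intro Bochner_Integration.integral_cong) (auto simp: indicator_def)
  also have "\<dots> = measure m ({h \<in> norm_ball H N t. x #>\<^bsub>G\<^esub> h \<in> E} \<inter> space m)"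
    by simp
  also have "{h \<in> norm_ball H N t. x #>\<^bsub>G\<^esub> h \<in> E} \<inter> space m = {h \<in> norm_ball H N t. x #>\<^bsub>G\<^esub> h \<in> E}"
    by (auto simp: space_m norm_ball_def)
  finally show ?thesis
    by (simp add: ball_average_def)
qed

section \<open>Volume growth of norm balls\<close>

lemma volume_lower:
  assumes "0 < \<epsilon>"
  obtains c where "0 < c" "\<And>t. 1 \<le> t \<Longrightarrow> c * t powr (d - \<epsilon>) \<le> V t"
proof -
  obtain c where c: "0 < c" "\<And>t. 1 \<le> t \<Longrightarrow> t powr (d - \<epsilon>) \<le> c * V t"
    using growth assms unfolding growth_exponents_def dominated_def by blast
  show thesis
    by (rule that[of "inverse c"]) (use c in \<open>auto simp: field_simps\<close>)
qed

lemma volume_upper: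
  assumes "0 < \<epsilon>"
  obtains c where "0 < c" "\<And>t. 1 \<le> t \<Longrightarrow> V t \<le> c * t powr (d + \<epsilon>)"
  using growth assms unfolding growth_exponents_def dominated_def by blast

lemma volume_pos: "1 \<le> t \<Longrightarrow> 0 < V t"
proof -
  assume t: "1 \<le> t"
  obtain c where "0 < c" "\<And>t. 1 \<le> t \<Longrightarrow> c * t powr (d - 1) \<le> V t"
    using volume_lower[of 1] by auto
  moreover have "0 < c * t powr (d - 1)"
    using t \<open>0 < c\<close> by simp
  ultimately show ?thesis
    using t by (meson less_le_trans)
qed

text \<open>Both properties are read off from positive volume, because \<open>measure\<close> is
  zero on sets that are not measurable or have infinite measure.\<close>

lemma norm_ball_fmeasurable:
  assumes "1 \<le> t"
  shows "norm_ball H N t \<in> fmeasurable m"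
proof (rule fmeasurableI)
  show "norm_ball H N t \<in> sets m"
    using volume_pos[OF assms] measure_notin_sets[of "norm_ball H N t" m] by linarith
  show "emeasure m (norm_ball H N t) < \<infinity>"
    using volume_pos[OF assms] by (auto simp: measure_def enn2real_positive_iff)
qed

text \<open>Arbitrary subsets are covered, since \<open>measure\<close> vanishes on those that are
  not measurable.\<close>

lemma volume_mono:
  assumes "S \<subseteq> norm_ball H N t" "1 \<le> t"
  shows "measure m S \<le> V t"
proof (cases "S \<in> sets m")
  case True
  with assms show ?thesis
    by (intro measure_mono_fmeasurable norm_ball_fmeasurable)
next
  case False
  then show ?thesis
    by (simp add: measure_notin_sets)
qed

text \<open>Balls increase with the radius, so their volumes stay above \<open>V 1 > 0\<close>. A
  negative \<open>d\<close> would make the upper growth bound tend to zero; taking half of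
  \<open>- d\<close> as the error keeps the exponent negative.\<close>

lemma exponent_nonneg: "0 \<le> d"
proof (rule ccontr)
  assume "\<not> 0 \<le> d"
  then have "d < 0" by simp
  then obtain c where c: "\<And>t. 1 \<le> t \<Longrightarrow> V t \<le> c * t powr (d + - d / 2)"
    using volume_upper[of "- d / 2"] by auto
  have "eventually (\<lambda>k. c * (2 ^ k) powr (d / 2) < V 1 * (2 ^ k) powr 0) sequentially"
    using \<open>d < 0\<close> volume_pos[of 1] by (intro eventually_dyadic_powr_less) auto
  then obtain k :: nat where "c * (2 ^ k) powr (d / 2) < V 1"
    by (auto dest: eventually_happens)
  moreover have "V 1 \<le> V (2 ^ k)"
    by (rule volume_mono) (auto simp: norm_ball_def intro: order_trans)
  moreover have "V (2 ^ k) \<le> c * (2 ^ k) powr (d / 2)"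
    using c[of "2 ^ k"] by simp
  ultimately show False by simp
qed

section \<open>Deviation of ball averages from the mean\<close>

text \<open>Temperedness is applied to an indicator, whose squared L2 norm is
  \<open>measure \<mu> E\<close>, and the result is fed into Chebyshev's inequality. The constant is
  uniform in \<open>E\<close>, \<open>t\<close> and \<open>\<delta>\<close>, so the set may change
  with the radius, and the factor \<open>measure \<mu> E\<close> is kept because both applications
  rely on it.\<close>

lemma deviation_bound:
  assumes "0 < \<kappa>" "\<kappa> < 1 / 2"
  obtains C where "0 < C"
    "\<And>E t \<delta>. E \<in> sets \<mu> \<Longrightarrow> 1 \<le> t \<Longrightarrow> 0 < \<delta> \<Longrightarrow>
       {x \<in> space \<mu>. \<delta> \<le> \<bar>ball_average G H N m t (indicator E) x - measure \<mu> E\<bar>} \<in> sets \<mu>"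
    "\<And>E t \<delta>. E \<in> sets \<mu> \<Longrightarrow> 1 \<le> t \<Longrightarrow> 0 < \<delta> \<Longrightarrow>
       measure \<mu> {x \<in> space \<mu>. \<delta> \<le> \<bar>ball_average G H N m t (indicator E) x - measure \<mu> E\<bar>}
         \<le> C * V t powr (- 2 * \<kappa>) * measure \<mu> E / \<delta>\<^sup>2"
proof -
  obtain C where C: "0 < C" and T: "\<And>f t. square_integrable \<mu> f \<Longrightarrow> 1 \<le> t \<Longrightarrow>
     square_integrable \<mu> (\<lambda>x. ball_average G H N m t f x - (LINT y|\<mu>. f y)) \<and>
     l2_norm \<mu> (\<lambda>x. ball_average G H N m t f x - (LINT y|\<mu>. f y)) \<le> C * V t powr (- \<kappa>) * l2_norm \<mu> f"
    using tempered[unfolded tempered_def, rule_format, OF conjI[OF assms]] by metis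
  have sq: "(\<lambda>x. (indicator E x :: real)\<^sup>2) = indicator E" for E :: "'a set set"
    by (auto simp: indicator_def)
  have *: "square_integrable \<mu> (\<lambda>x. ball_average G H N m t (indicator E) x - measure \<mu> E)"
      "l2_norm \<mu> (\<lambda>x. ball_average G H N m t (indicator E) x - measure \<mu> E)
        \<le> C * V t powr (- \<kappa>) * sqrt (measure \<mu> E)"
    if "E \<in> sets \<mu>" "1 \<le> t" for E t
  proof -
    have "square_integrable \<mu> (indicator E)"
      using that by (auto simp: square_integrable_def sq emeasure_eq_measure)
    moreover have "(LINT y|\<mu>. indicator E y) = measure \<mu> E"
      using that sets.sets_into_space[of E \<mu>] by (simp add: Int_absorb2)
    ultimately show "square_integrable \<mu> (\<lambda>x. ball_average G H N m t (indicator E) x - measure \<mu> E)"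
      "l2_norm \<mu> (\<lambda>x. ball_average G H N m t (indicator E) x - measure \<mu> E)
        \<le> C * V t powr (- \<kappa>) * sqrt (measure \<mu> E)"
      using T[of "indicator E" t] that by (auto simp: l2_norm_def sq)
  qed
  show thesis
  \<comment> \<open>The tempered bound is squared in Chebyshev's inequality, hence
    \<open>C\<^sup>2\<close> and the exponent \<open>- 2 * \<kappa>\<close>.\<close>
  proof (rule that[of "C\<^sup>2"])
    show "0 < C\<^sup>2" using C by simp
  next
    fix E and t \<delta> :: real assume a: "E \<in> sets \<mu>" "1 \<le> t" "0 < \<delta>"
    let ?f = "\<lambda>x. ball_average G H N m t (indicator E) x - measure \<mu> E"
    show "{x \<in> space \<mu>. \<delta> \<le> \<bar>?f x\<bar>} \<in> sets \<mu>"
      using measure_abs_ge_l2_norm(1)[OF finite_measure_axioms *(1) a(3)] a by simp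
    have "measure \<mu> {x \<in> space \<mu>. \<delta> \<le> \<bar>?f x\<bar>} \<le> (l2_norm \<mu> ?f)\<^sup>2 / \<delta>\<^sup>2"
      using measure_abs_ge_l2_norm(2)[OF finite_measure_axioms *(1) a(3)] a by simp
    also have "\<dots> \<le> (C * V t powr (- \<kappa>) * sqrt (measure \<mu> E))\<^sup>2 / \<delta>\<^sup>2"
      using *(2)[of E t] a by (intro divide_right_mono power_mono) (auto simp: l2_norm_def)
    also have "\<dots> = C\<^sup>2 * V t powr (- 2 * \<kappa>) * measure \<mu> E / \<delta>\<^sup>2"
      by (simp add: power_mult_distrib power2_eq_square[of "V t powr _"] powr_add[symmetric])
    finally show "measure \<mu> {x \<in> space \<mu>. \<delta> \<le> \<bar>?f x\<bar>} \<le> C\<^sup>2 * V t powr (- 2 * \<kappa>) * measure \<mu> E / \<delta>\<^sup>2" .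
  qed
qed

section \<open>Measures of the targets and of their thickenings\<close>

lemma targets_measurable: "1 \<le> t \<Longrightarrow> A t \<in> sets \<mu>"
  using targets by (simp add: shrinking_targets_def)

lemma targets_antimono: "1 \<le> s \<Longrightarrow> s \<le> t \<Longrightarrow> A t \<subseteq> A s"
  using targets by (simp add: shrinking_targets_def)

lemma targets_measure_lower:
  obtains a where "0 < a" "\<And>t. 1 \<le> t \<Longrightarrow> a / t \<le> measure \<mu> (A t)"
proof -
  obtain c where "1 < c" "\<And>t. 1 \<le> t \<Longrightarrow> 1 / t \<le> c * measure \<mu> (A t)"
    using targets unfolding shrinking_targets_def comparable_def by blast
  then show thesis
    by (intro that[of "inverse c"]) (auto simp: field_simps)
qed

text \<open>The thickened target need not be measurable, whereas the deviation bound needs a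
  measurable set. A measurable hull attaining the outer measure serves instead, and stability keeps
  it of size \<open>1 / t\<close>.\<close>

lemma thickened_targets:
  obtains b where "0 < b"
    "\<And>t. 1 \<le> t \<Longrightarrow> \<exists>E\<in>sets \<mu>. {x #>\<^bsub>G\<^esub> h | x h. x \<in> A t \<and> h \<in> norm_ball H N 1} \<subseteq> E
        \<and> measure \<mu> E \<le> b / t"
proof -
  let ?AH = "\<lambda>t. {x #>\<^bsub>G\<^esub> h | x h. x \<in> A t \<and> h \<in> norm_ball H N 1}"
  obtain c where c: "1 < c" "\<And>t. 1 \<le> t \<Longrightarrow> inverse c * measure \<mu> (A t) \<le> 1 / t"
    using targets unfolding shrinking_targets_def comparable_def by blast
  obtain c' where c': "1 < c'" "\<And>t. 1 \<le> t \<Longrightarrow>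
      enn2real (outer_measure_of \<mu> (?AH t)) \<le> c' * measure \<mu> (A t)"
    using stable unfolding stable_under_perturbations_def comparable_def by blast
  show thesis
  \<comment> \<open>\<open>c'\<close> is the loss from thickening, \<open>c\<close> the loss in
    comparing the target with \<open>1 / t\<close>.\<close>
  proof (rule that[of "c' * c"])
    show "0 < c' * c" using c c' by simp
  next
    fix t :: real assume t: "1 \<le> t"
    have "?AH t \<subseteq> space \<mu>"
      using sets.sets_into_space[OF targets_measurable[OF t]] H_carrier rcosets_translate
      by (auto simp: space_\<mu> norm_ball_def)
    from outer_measure_of_attain[OF this]
    obtain E where E: "E \<in> sets \<mu>" "?AH t \<subseteq> E" "outer_measure_of \<mu> (?AH t) = emeasure \<mu> E"
      by (elim bexE conjE) (rule that)
    have "measure \<mu> E \<le> c' * measure \<mu> (A t)"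
      using c'(2)[OF t] E by (simp add: measure_def)
    also have "\<dots> \<le> c' * (c / t)"
      using c(2)[OF t] c(1) c'(1) by (intro mult_left_mono) (auto simp: field_simps)
    also have "\<dots> = c' * c / t"
      by simp
    finally show "\<exists>E\<in>sets \<mu>. ?AH t \<subseteq> E \<and> measure \<mu> E \<le> c' * c / t"
      using E(1,2) by (intro bexI[of _ E] conjI)
  qed
qed

section \<open>Visits to the targets, unbounded below the growth exponent\<close>

abbreviation hits :: "real \<Rightarrow> 'a set \<Rightarrow> 'a set" where
  "hits \<eta> x \<equiv> {h \<in> H. 1 \<le> N h \<and> x #>\<^bsub>G\<^esub> h \<in> A (N h powr \<eta>)}"

text \<open>For norms at least one, a larger exponent selects a later and hence smaller target. This
  lets countably many exponents control all of them.\<close>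

lemma hits_antimono:
  assumes "0 \<le> \<eta>" "\<eta> \<le> \<eta>'"
  shows "hits \<eta>' x \<subseteq> hits \<eta> x"
proof
  fix h assume h: "h \<in> hits \<eta>' x"
  have "A (N h powr \<eta>') \<subseteq> A (N h powr \<eta>)"
    using assms h by (intro targets_antimono powr_mono) (auto simp: ge_one_powr_ge_zero)
  with h show "h \<in> hits \<eta> x" by auto
qed

lemma hits_unbounded:
  assumes \<eta>: "0 \<le> \<eta>" "\<eta> < d"
  shows "AE x in \<mu>. \<not> norm_bounded N (hits \<eta> x)"
proof -
  \<comment> \<open>The gap between \<open>p\<close> and \<open>d\<close> absorbs the error in the
    growth hypothesis: volumes are at least a multiple of \<open>t powr p\<close>, and still
    \<open>\<eta> < p\<close>.\<close>
  obtain p where p: "\<eta> < p" "p < d"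
    using \<eta> dense by blast
  then have p0: "0 < p" using \<eta> by simp
  \<comment> \<open>The bad sets will have measure of order at most
    \<open>t powr (\<eta> - 2 * \<kappa> * p)\<close>. This decays once \<open>\<kappa>\<close> is
    close enough to \<open>1 / 2\<close>, because \<open>\<eta> < p\<close>; the
    \<open>max 0\<close> makes \<open>\<kappa>\<close> positive.\<close>
  have half: "max 0 (\<eta> / (2 * p)) < 1 / 2"
    using p p0 by (simp add: max_def divide_less_eq)
  obtain \<kappa> where \<kappa>: "max 0 (\<eta> / (2 * p)) < \<kappa>" "\<kappa> < 1 / 2"
    using dense[OF half] by blast
  then have \<kappa>0: "0 < \<kappa>" and "\<eta> / (2 * p) < \<kappa>"
    by simp_all
  then have rate: "\<eta> < 2 * \<kappa> * p"
    using p0 by (simp add: divide_less_eq mult_ac)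
  obtain c where c: "0 < c" "\<And>t. 1 \<le> t \<Longrightarrow> c * t powr p \<le> V t"
    using volume_lower[of "d - p"] p by auto
  obtain a where a: "0 < a" "\<And>t. 1 \<le> t \<Longrightarrow> a / t \<le> measure \<mu> (A t)"
    by (rule targets_measure_lower) blast
  obtain C where C: "0 < C"
    and meas: "\<And>E t \<delta>. E \<in> sets \<mu> \<Longrightarrow> 1 \<le> t \<Longrightarrow> 0 < \<delta> \<Longrightarrow>
       {x \<in> space \<mu>. \<delta> \<le> \<bar>ball_average G H N m t (indicator E) x - measure \<mu> E\<bar>} \<in> sets \<mu>"
    and dev: "\<And>E t \<delta>. E \<in> sets \<mu> \<Longrightarrow> 1 \<le> t \<Longrightarrow> 0 < \<delta> \<Longrightarrow>
       measure \<mu> {x \<in> space \<mu>. \<delta> \<le> \<bar>ball_average G H N m t (indicator E) x - measure \<mu> E\<bar>}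
         \<le> C * V t powr (- 2 * \<kappa>) * measure \<mu> E / \<delta>\<^sup>2"
    using deviation_bound[OF \<kappa>0 \<kappa>(2)] by blast
  define t :: "nat \<Rightarrow> real" where "t k = 2 ^ k" for k
  define E where "E k = A (t k powr \<eta>)" for k
  \<comment> \<open>The threshold is half the mean, so outside \<open>B k\<close> the average still
    exceeds half the mean.\<close>
  define B where "B k = {x \<in> space \<mu>. measure \<mu> (E k) / 2 \<le>
      \<bar>ball_average G H N m (t k) (indicator (E k)) x - measure \<mu> (E k)\<bar>}" for k
  have t1: "1 \<le> t k" "1 \<le> t k powr \<eta>" for k
    using \<eta> by (auto simp: t_def ge_one_powr_ge_zero)
  have E: "E k \<in> sets \<mu>" for k
    using t1 by (simp add: E_def targets_measurable)
  have \<mu>E: "a * t k powr (- \<eta>) \<le> measure \<mu> (E k)" for k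
    using a(2)[OF t1(2)[of k]] by (simp add: E_def powr_minus divide_inverse)
  have \<mu>E0: "0 < measure \<mu> (E k)" for k
    using \<mu>E[of k] a(1) t1(1)[of k] by (smt (verit) mult_pos_pos powr_gt_zero)
  have "measure \<mu> (B k) \<le> (4 * C * c powr (- 2 * \<kappa>) / a) * t k powr (- (2 * \<kappa> * p - \<eta>))" for k
  proof -
    have "measure \<mu> (B k) \<le> C * V (t k) powr (- 2 * \<kappa>) * measure \<mu> (E k) / (measure \<mu> (E k) / 2)\<^sup>2"
      unfolding B_def using E t1 \<mu>E0 by (intro dev) auto
    \<comment> \<open>One factor of the target measure cancels against the squared threshold. Volume
      and target measure now both enter with negative exponents, so their lower bounds give the
      estimate.\<close>
    also have "\<dots> = 4 * C * V (t k) powr (- 2 * \<kappa>) / measure \<mu> (E k)"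
      using \<mu>E0[of k] by (simp add: field_simps power2_eq_square)
    also have "\<dots> \<le> 4 * C * (c * t k powr p) powr (- 2 * \<kappa>) / (a * t k powr (- \<eta>))"
      using C c t1(1)[of k] a \<mu>E[of k] \<kappa>0 
      by (intro frac_le mult_left_mono powr_mono2') auto
    also have "\<dots> = (4 * C * c powr (- 2 * \<kappa>) / a) * t k powr (- (2 * \<kappa> * p - \<eta>))"
      using c t1(1)[of k]
      by (simp add: powr_mult powr_powr powr_minus powr_diff divide_inverse algebra_simps powr_add)
    finally show ?thesis .
  qed
  moreover have "B k \<in> sets \<mu>" for k
    unfolding B_def using E t1 \<mu>E0 by (intro meas) auto
  moreover have "summable (\<lambda>k. (4 * C * c powr (- 2 * \<kappa>) / a) * t k powr (- (2 * \<kappa> * p - \<eta>)))"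
    unfolding t_def using rate by (intro summable_mult summable_powr_dyadic) simp
  ultimately have "AE x in \<mu>. eventually (\<lambda>k. x \<notin> B k) sequentially"
    by (rule borel_cantelli_summable_bound)
  then show ?thesis
    using AE_space
  proof eventually_elim
    case (elim x)
    show ?case
    proof
      assume "norm_bounded N (hits \<eta> x)"
      then obtain R where R: "\<And>h. h \<in> hits \<eta> x \<Longrightarrow> N h \<le> R"
        unfolding norm_bounded_def by blast
      \<comment> \<open>Radius at least one makes the ball of finite volume and also captures the
        elements of norm at most one, which \<open>R\<close> need not bound.\<close>
      let ?R = "max 1 R"
      \<comment> \<open>For \<open>x\<close> outside \<open>B k\<close> the visits in the ball of
        radius \<open>t k\<close> have volume at least
        \<open>(c * a / 2) * t k powr (p - \<eta>)\<close>. For large \<open>k\<close> this is more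
        than the ball of radius \<open>?R\<close> can hold.\<close>
      have "eventually (\<lambda>k. V ?R * t k powr \<eta> < (c * a / 2) * t k powr p) sequentially"
        unfolding t_def using p c a by (intro eventually_dyadic_powr_less) auto
      with elim(1) obtain k where k: "x \<notin> B k" "V ?R * t k powr \<eta> < (c * a / 2) * t k powr p"
        by (metis (mono_tags, lifting) eventually_conj eventually_happens sequentially_bot)
      let ?S = "{h \<in> norm_ball H N (t k). x #>\<^bsub>G\<^esub> h \<in> E k}"
      have "?S \<subseteq> norm_ball H N ?R"
      proof
        fix h assume h: "h \<in> ?S"
        show "h \<in> norm_ball H N ?R"
        proof (cases "N h \<le> 1")
          case True
          with h show ?thesis by (auto simp: norm_ball_def)
        next
          case False
          \<comment> \<open>Inside the ball \<open>N h \<le> t k\<close>, so a visit to the target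
            at scale \<open>t k\<close> is also a visit to the larger target at scale
            \<open>N h\<close>.\<close>
          then have "A (t k powr \<eta>) \<subseteq> A (N h powr \<eta>)"
            using h \<eta> by (intro targets_antimono powr_mono2) (auto simp: norm_ball_def ge_one_powr_ge_zero)
          with False h have "h \<in> hits \<eta> x" by (auto simp: norm_ball_def E_def)
          with R h show ?thesis by (fastforce simp: norm_ball_def)
        qed
      qed
      then have "measure m ?S \<le> V ?R"
        by (rule volume_mono) simp
      moreover have "measure \<mu> (E k) / 2 < measure m ?S / V (t k)"
        using k(1) elim(2) abs_ge_minus_self[of "measure m ?S / V (t k) - measure \<mu> (E k)"]
        by (simp add: B_def ball_average_indicator not_le)
      ultimately have "V (t k) * measure \<mu> (E k) / 2 < V ?R"
        using volume_pos[OF t1(1)[of k]] by (simp add: field_simps)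
      moreover have "(c * t k powr p) * (a * t k powr (- \<eta>)) \<le> V (t k) * measure \<mu> (E k)"
        using c t1(1)[of k] \<mu>E a by (intro mult_mono) auto
      ultimately have "(c * t k powr p) * (a * t k powr (- \<eta>)) / 2 < V ?R"
        by simp
      then have "(c * t k powr p) * (a * t k powr (- \<eta>)) / 2 * t k powr \<eta> < V ?R * t k powr \<eta>"
        using t1(1)[of k] by (intro mult_strict_right_mono) auto
      moreover have "(c * t k powr p) * (a * t k powr (- \<eta>)) / 2 * t k powr \<eta> = (c * a / 2) * t k powr p"
        using t1(1)[of k] powr_gt_zero[of "t k" \<eta>] by (simp add: powr_minus field_simps)
      ultimately have "(c * a / 2) * t k powr p < V ?R * t k powr \<eta>"
        by (simp only:)
      with k(2) show False by simp
    qed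
  qed
qed

section \<open>Visits bounded above the growth exponent\<close>

text \<open>This fixes how far the radius must be enlarged for a ball to contain
  \<open>g H\<^sub>1\<close> as well as \<open>g\<close>.\<close>

lemma norm_mult_bound:
  obtains c where "1 \<le> c"
    "\<And>g h t. g \<in> H \<Longrightarrow> h \<in> norm_ball H N 1 \<Longrightarrow> N g \<le> t \<Longrightarrow> 1 \<le> t \<Longrightarrow> N (g \<otimes>\<^bsub>G\<^esub> h) \<le> c * t"
proof -
  obtain c where c: "\<And>g h. g \<in> H \<Longrightarrow> h \<in> H \<Longrightarrow>
      N (g \<otimes>\<^bsub>G\<^esub> h) \<le> c * max 1 (N g) * max 1 (N h)"
    using N unfolding group_norm_def by auto
  show thesis
  \<comment> \<open>\<open>group_norm\<close> puts no lower bound on its constant; the later radii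
    need one that is at least one.\<close>
  proof (rule that[of "max 1 c"])
    fix g h and t :: real assume *: "g \<in> H" "h \<in> norm_ball H N 1" "N g \<le> t" "1 \<le> t"
    then have "N (g \<otimes>\<^bsub>G\<^esub> h) \<le> c * max 1 (N g)"
      using c[of g h] by (simp add: norm_ball_def max_absorb1)
    also have "\<dots> \<le> max 1 c * t"
      using * by (intro mult_mono) auto
    finally show "N (g \<otimes>\<^bsub>G\<^esub> h) \<le> max 1 c * t" .
  qed simp
qed

text \<open>Left invariance of Haar measure gives the volume. Measurability of the translate then
  follows from that volume being positive, as \<open>measure\<close> is zero on sets that are not
  measurable.\<close>

lemma translate_unit_ball:
  assumes "g \<in> H"
  shows "g <#\<^bsub>G\<^esub> norm_ball H N 1 \<in> sets m" "measure m (g <#\<^bsub>G\<^esub> norm_ball H N 1) = V 1"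
proof -
  have "norm_ball H N 1 \<in> sets m"
    using norm_ball_fmeasurable[of 1] by auto
  then have "emeasure m (g <#\<^bsub>subgrp G H\<^esub> norm_ball H N 1) = emeasure m (norm_ball H N 1)"
    using m assms by (simp add: haar_measure_def)
  moreover have "g <#\<^bsub>subgrp G H\<^esub> norm_ball H N 1 = g <#\<^bsub>G\<^esub> norm_ball H N 1"
    by (simp add: l_coset_def)
  ultimately have "emeasure m (g <#\<^bsub>G\<^esub> norm_ball H N 1) = emeasure m (norm_ball H N 1)"
    by simp
  then show eq: "measure m (g <#\<^bsub>G\<^esub> norm_ball H N 1) = V 1"
    by (simp add: measure_def)
  show "g <#\<^bsub>G\<^esub> norm_ball H N 1 \<in> sets m"
    using eq volume_pos[of 1] measure_notin_sets[of "g <#\<^bsub>G\<^esub> norm_ball H N 1" m] by linarith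
qed

text \<open>Once \<open>x\<close> hits the target at \<open>g\<close>, it hits the thickened target on all of \<open>g H\<^sub>1\<close>.\<close>

lemma visit_volume:
  assumes "x \<in> space \<mu>" "E \<in> sets \<mu>" "1 \<le> s"
    and AH: "{y #>\<^bsub>G\<^esub> h | y h. y \<in> Y \<and> h \<in> norm_ball H N 1} \<subseteq> E"
    and g: "g \<in> H" "x #>\<^bsub>G\<^esub> g \<in> Y" "\<And>h. h \<in> norm_ball H N 1 \<Longrightarrow> N (g \<otimes>\<^bsub>G\<^esub> h) \<le> s"
  shows "V 1 \<le> measure m {h \<in> norm_ball H N s. x #>\<^bsub>G\<^esub> h \<in> E}"
proof -
  let ?S = "{h \<in> norm_ball H N s. x #>\<^bsub>G\<^esub> h \<in> E}"
  have "?S = norm_ball H N s \<inter> {h \<in> H. x #>\<^bsub>G\<^esub> h \<in> E}"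
    by (auto simp: norm_ball_def)
  \<comment> \<open>Monotonicity of \<open>measure\<close> needs the larger set to be measurable and
    of finite measure; this is where \<open>orbit_measurable\<close> enters.\<close>
  then have S: "?S \<in> fmeasurable m"
    using fmeasurable_Int_fmeasurable[OF norm_ball_fmeasurable[OF assms(3)] orbit_measurable] assms
    by (simp add: space_\<mu>)
  have x: "x \<subseteq> carrier G"
    using assms(1) rcosets_part_G[OF \<Gamma>] by (auto simp: space_\<mu>)
  have "g <#\<^bsub>G\<^esub> norm_ball H N 1 \<subseteq> ?S"
  proof
    fix h assume "h \<in> g <#\<^bsub>G\<^esub> norm_ball H N 1"
    then obtain u where u: "u \<in> norm_ball H N 1" "h = g \<otimes>\<^bsub>G\<^esub> u"
      by (auto simp: l_coset_def)
    then have uH: "u \<in> H" by (simp add: norm_ball_def)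
    have "x #>\<^bsub>G\<^esub> h = (x #>\<^bsub>G\<^esub> g) #>\<^bsub>G\<^esub> u"
      using coset_mult_assoc[OF x subsetD[OF H_carrier g(1)] subsetD[OF H_carrier uH]] u(2) by simp
    then have "x #>\<^bsub>G\<^esub> h \<in> E"
      using AH g(2) u(1) by blast
    moreover have "h \<in> H"
      using u g uH H by (simp add: subgroup.m_closed)
    ultimately show "h \<in> ?S"
      using g(3)[OF u(1)] u by (simp add: norm_ball_def)
  qed
  from measure_mono_fmeasurable[OF this translate_unit_ball(1)[OF g(1)] S] show ?thesis
    by (simp only: translate_unit_ball(2)[OF g(1)])
qed

lemma hits_bounded:
  assumes \<eta>: "d < \<eta>"
  shows "AE x in \<mu>. norm_bounded N (hits \<eta> x)"
proof -
  \<comment> \<open>Now volumes are at most a multiple of \<open>t powr p\<close>, with room left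
    below \<open>\<eta>\<close>.\<close>
  obtain p where p: "d < p" "p < \<eta>"
    using \<eta> dense by blast
  then have p0: "0 < p" "0 < \<eta>" using exponent_nonneg by auto
  \<comment> \<open>The bad sets will have measure of order at most
    \<open>t powr (p * (2 - 2 * \<kappa>) - \<eta>)\<close>. As \<open>\<kappa>\<close> approaches
    \<open>1 / 2\<close> the exponent approaches \<open>p - \<eta> < 0\<close>.\<close>
  have half: "max 0 (1 - \<eta> / (2 * p)) < 1 / 2"
    using p p0 by (simp add: max_def less_divide_eq)
  obtain \<kappa> where \<kappa>: "max 0 (1 - \<eta> / (2 * p)) < \<kappa>" "\<kappa> < 1 / 2"
    using dense[OF half] by blast
  then have \<kappa>0: "0 < \<kappa>" and "1 - \<kappa> < \<eta> / (2 * p)"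
    by simp_all
  then have rate: "p * (2 - 2 * \<kappa>) < \<eta>"
    using p0 by (simp add: less_divide_eq algebra_simps)
  obtain c where c: "0 < c" "\<And>t. 1 \<le> t \<Longrightarrow> V t \<le> c * t powr p"
    using volume_upper[of "p - d"] p by auto
  obtain b where b: "0 < b" and thick: "\<And>t. 1 \<le> t \<Longrightarrow> \<exists>E\<in>sets \<mu>.
      {x #>\<^bsub>G\<^esub> h | x h. x \<in> A t \<and> h \<in> norm_ball H N 1} \<subseteq> E \<and> measure \<mu> E \<le> b / t"
    by (rule thickened_targets) blast
  obtain C where C: "0 < C"
    and meas: "\<And>E t \<delta>. E \<in> sets \<mu> \<Longrightarrow> 1 \<le> t \<Longrightarrow> 0 < \<delta> \<Longrightarrow>
       {x \<in> space \<mu>. \<delta> \<le> \<bar>ball_average G H N m t (indicator E) x - measure \<mu> E\<bar>} \<in> sets \<mu>"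
    and dev: "\<And>E t \<delta>. E \<in> sets \<mu> \<Longrightarrow> 1 \<le> t \<Longrightarrow> 0 < \<delta> \<Longrightarrow>
       measure \<mu> {x \<in> space \<mu>. \<delta> \<le> \<bar>ball_average G H N m t (indicator E) x - measure \<mu> E\<bar>}
         \<le> C * V t powr (- 2 * \<kappa>) * measure \<mu> E / \<delta>\<^sup>2"
    using deviation_bound[OF \<kappa>0 \<kappa>(2)] by blast
  obtain q where q: "1 \<le> q" "\<And>g h t. g \<in> H \<Longrightarrow> h \<in> norm_ball H N 1 \<Longrightarrow> N g \<le> t \<Longrightarrow> 1 \<le> t \<Longrightarrow>
      N (g \<otimes>\<^bsub>G\<^esub> h) \<le> q * t"
    using norm_mult_bound by blast
  define t :: "nat \<Rightarrow> real" where "t k = 2 ^ k" for k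
  \<comment> \<open>A visit \<open>h\<close> at dyadic scale \<open>k\<close> has norm at most
    \<open>2 * t k\<close>; the factor \<open>q\<close> makes room for its translate
    \<open>h H\<^sub>1\<close>.\<close>
  define s where "s k = (2 * q) * t k" for k
  define v where "v = V 1"
  have t1: "1 \<le> t k" "1 \<le> t k powr \<eta>" for k
    using p0 by (auto simp: t_def ge_one_powr_ge_zero)
  have s1: "1 \<le> s k" for k
    using mult_mono[of 1 "2 * q" 1 "t k"] q(1) t1(1)[of k] by (simp add: s_def)
  have v0: "0 < v" and Vs0: "0 < V (s k)" for k
    using volume_pos s1 by (auto simp: v_def)
  have "\<forall>k. \<exists>E. E \<in> sets \<mu> \<and>
      {x #>\<^bsub>G\<^esub> h | x h. x \<in> A (t k powr \<eta>) \<and> h \<in> norm_ball H N 1} \<subseteq> E \<and>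
      measure \<mu> E \<le> b / t k powr \<eta>"
    using thick[OF t1(2), unfolded Bex_def] by (rule allI)
  from choice[OF this] obtain E where E: "\<And>k. E k \<in> sets \<mu>"
    "\<And>k. {x #>\<^bsub>G\<^esub> h | x h. x \<in> A (t k powr \<eta>) \<and> h \<in> norm_ball H N 1} \<subseteq> E k"
    "\<And>k. measure \<mu> (E k) \<le> b / t k powr \<eta>"
    by blast
  have \<mu>E: "measure \<mu> (E k) \<le> b * t k powr (- \<eta>)" for k
    using E(3)[of k] by (simp add: powr_minus divide_inverse)
  define c' where "c' = c * (2 * q) powr p"
  have c'0: "0 < c'"
    using c q by (simp add: c'_def)
  have Vs: "V (s k) \<le> c' * t k powr p" for k
    using c(2)[OF s1[of k]] q(1) t1(1)[of k] by (simp add: s_def c'_def powr_mult mult.assoc)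
  \<comment> \<open>A single visit at scale \<open>k\<close> forces an average of at least
    \<open>v / V (s k)\<close>, and the mean is eventually at most half of that. The threshold is
    the remaining half.\<close>
  define B where "B k = {x \<in> space \<mu>. v / (2 * V (s k)) \<le>
      \<bar>ball_average G H N m (s k) (indicator (E k)) x - measure \<mu> (E k)\<bar>}" for k
  define K where "K = 4 * C * c' powr (2 - 2 * \<kappa>) * b / v\<^sup>2"
  have "measure \<mu> (B k) \<le> K * t k powr (- (\<eta> - p * (2 - 2 * \<kappa>)))" for k
  proof -
    have "measure \<mu> (B k) \<le> C * V (s k) powr (- 2 * \<kappa>) * measure \<mu> (E k) / (v / (2 * V (s k)))\<^sup>2"
      unfolding B_def using E s1 v0 Vs0 by (intro dev) auto
    \<comment> \<open>The squared threshold contributes \<open>V (s k) powr 2\<close>. The total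
      exponent \<open>2 - 2 * \<kappa>\<close> is positive, so the upper bounds on volume and hull
      are the ones to insert.\<close>
    also have "\<dots> = 4 * C * (V (s k) powr 2 * V (s k) powr (- 2 * \<kappa>)) * measure \<mu> (E k) / v\<^sup>2"
      using Vs0[of k] v0 by (simp add: field_simps power2_eq_square powr_numeral)
    also have "\<dots> = 4 * C * V (s k) powr (2 - 2 * \<kappa>) * measure \<mu> (E k) / v\<^sup>2"
      unfolding powr_add[symmetric] by simp
    also have "\<dots> \<le> 4 * C * (c' * t k powr p) powr (2 - 2 * \<kappa>) * (b * t k powr (- \<eta>)) / v\<^sup>2"
      using C Vs[of k] \<mu>E[of k] \<kappa> c'0
      by (intro divide_right_mono mult_mono mult_left_mono powr_mono2) auto
    also have "\<dots> = K * (t k powr (p * (2 - 2 * \<kappa>)) * t k powr (- \<eta>))"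
      using c'0 t1(1)[of k] by (simp add: K_def powr_mult powr_powr)
    also have "\<dots> = K * t k powr (- (\<eta> - p * (2 - 2 * \<kappa>)))"
      by (simp add: powr_add[symmetric])
    finally show ?thesis .
  qed
  moreover have "B k \<in> sets \<mu>" for k
    unfolding B_def using E s1 v0 Vs0 by (intro meas) auto
  moreover have "summable (\<lambda>k. K * t k powr (- (\<eta> - p * (2 - 2 * \<kappa>))))"
    unfolding t_def using rate by (intro summable_mult summable_powr_dyadic) simp
  ultimately have "AE x in \<mu>. eventually (\<lambda>k. x \<notin> B k) sequentially"
    by (rule borel_cantelli_summable_bound)
  then show ?thesis
    using AE_space
  proof eventually_elim
    case (elim x)
    have "eventually (\<lambda>k. (2 * b * c') * t k powr p < v * t k powr \<eta>) sequentially"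
      unfolding t_def using p v0 by (intro eventually_dyadic_powr_less) auto
    with elim(1) have "eventually (\<lambda>k. x \<notin> B k \<and> (2 * b * c') * t k powr p < v * t k powr \<eta>) sequentially"
      by (rule eventually_conj)
    \<comment> \<open>From here \<open>K\<close> is an index threshold depending on
      \<open>x\<close>, no longer the constant in the bound on \<open>B k\<close>.\<close>
    then obtain K where K: "\<And>k. K \<le> k \<Longrightarrow> x \<notin> B k \<and> (2 * b * c') * t k powr p < v * t k powr \<eta>"
      by (auto simp: eventually_sequentially)
    have "N h \<le> 2 ^ K" if h: "h \<in> hits \<eta> x" for h
    proof (rule ccontr)
      assume "\<not> N h \<le> 2 ^ K"
      then have hK: "2 ^ K < N h" by simp
      \<comment> \<open>The dyadic scale of \<open>h\<close>: the floor gives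
        \<open>t k \<le> N h \<le> 2 * t k\<close>, and \<open>N h > 2 ^ K\<close> then forces
        \<open>K \<le> k\<close>.\<close>
      define k where "k = nat \<lfloor>log 2 (N h)\<rfloor>"
      have h1: "1 \<le> N h" using h by simp
      have kl: "t k \<le> N h" and ku: "N h \<le> 2 * t k"
      proof -
        have l0: "0 \<le> log 2 (N h)" using h1 by simp
        have "real k \<le> log 2 (N h)" "log 2 (N h) \<le> real (Suc k)"
          unfolding k_def using l0 by linarith+
        then show "t k \<le> N h" "N h \<le> 2 * t k"
          using h1 powr_realpow[of 2 k] powr_realpow[of 2 "Suc k"]
          by (auto simp: t_def le_log_iff log_le_iff simp del: of_nat_Suc)
      qed
      have "K \<le> k"
      proof (rule ccontr)
        assume "\<not> K \<le> k"
        then have "(2::real) ^ Suc k \<le> 2 ^ K" by (intro power_increasing) auto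
        with ku hK show False by (simp add: t_def)
      qed
      note k = K[OF this]
      have "A (N h powr \<eta>) \<subseteq> A (t k powr \<eta>)"
        using kl t1[of k] p0 by (intro targets_antimono powr_mono2) auto
      then have "x #>\<^bsub>G\<^esub> h \<in> A (t k powr \<eta>)" "h \<in> H"
        using h by auto
      moreover have "N (h \<otimes>\<^bsub>G\<^esub> u) \<le> s k" if "u \<in> norm_ball H N 1" for u
        using q(2)[OF \<open>h \<in> H\<close> that ku] t1(1)[of k] by (simp add: s_def mult_ac)
      ultimately have "v \<le> measure m {h \<in> norm_ball H N (s k). x #>\<^bsub>G\<^esub> h \<in> E k}"
        unfolding v_def using elim(2) E s1 by (intro visit_volume[where Y = "A (t k powr \<eta>)"]) auto
      then have "v / V (s k) \<le> ball_average G H N m (s k) (indicator (E k)) x"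
        using Vs0[of k] by (simp add: ball_average_indicator divide_right_mono)
      \<comment> \<open>The volume bound and the hull bound multiply to order
        \<open>t k powr (p - \<eta>)\<close>; the choice of \<open>K\<close> makes this small
        against \<open>v\<close>.\<close>
      moreover have "measure \<mu> (E k) \<le> v / (2 * V (s k))"
      proof -
        have "measure \<mu> (E k) * (2 * V (s k)) \<le> (b / t k powr \<eta>) * (2 * (c' * t k powr p))"
          using E(3)[of k] Vs[of k] b t1(1)[of k] by (intro mult_mono) auto
        also have "\<dots> = (2 * b * c') * t k powr p / t k powr \<eta>"
          by simp
        also have "\<dots> \<le> v"
          using k t1(1)[of k] by (simp add: field_simps)
        finally show ?thesis
          using Vs0[of k] by (simp add: field_simps)
      qed
      moreover have "v / V (s k) = v / (2 * V (s k)) + v / (2 * V (s k))"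
        using Vs0[of k] by (simp add: field_simps)
      ultimately have "v / (2 * V (s k)) \<le>
          \<bar>ball_average G H N m (s k) (indicator (E k)) x - measure \<mu> (E k)\<bar>"
        by linarith
      with elim(2) have "x \<in> B k"
        unfolding B_def by blast
      with k show False by simp
    qed
    then show ?case
      unfolding norm_bounded_def by blast
  qed
qed

section \<open>From exponents near \<open>d\<close> to the critical exponent\<close>

text \<open>Exponents approaching \<open>d\<close> from both sides determine the infimum: an
  admissible \<open>\<eta> < d\<close> would, by antitonicity, bound the visits at some
  \<open>d - 1 / (n + 1)\<close> above it. For \<open>d = 0\<close> the lower estimate is just that
  admissible exponents are nonnegative.\<close>

lemma critical_exponent_eq:
  assumes lower: "\<And>n::nat. 0 \<le> d - 1 / (n + 1) \<Longrightarrow> \<not> norm_bounded N (hits (d - 1 / (n + 1)) x)"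
    and upper: "\<And>n::nat. norm_bounded N (hits (d + 1 / (n + 1)) x)"
  shows "critical_exponent G H N A x = ereal d"
proof (rule antisym)
  show "critical_exponent G H N A x \<le> ereal d"
  proof (rule ereal_le_epsilon2)
    fix e :: real assume "0 < e"
    then obtain n :: nat where n: "1 / (n + 1) < e"
      using reals_Archimedean by (auto simp: inverse_eq_divide)
    have "critical_exponent G H N A x \<le> ereal (d + 1 / (n + 1))"
      unfolding critical_exponent_def using upper[of n] exponent_nonneg
      by (intro Inf_lower imageI CollectI conjI) (auto simp: add.commute)
    also have "\<dots> \<le> ereal d + ereal e" using n by simp
    finally show "critical_exponent G H N A x \<le> ereal d + ereal e" .
  qed
next
  show "ereal d \<le> critical_exponent G H N A x"
    unfolding critical_exponent_def
  proof (rule Inf_greatest, clarsimp)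
    fix \<eta> assume \<eta>: "0 \<le> \<eta>" "norm_bounded N (hits \<eta> x)"
    show "d \<le> \<eta>"
    proof (rule ccontr)
      assume "\<not> d \<le> \<eta>"
      then obtain n :: nat where n: "1 / (n + 1) < d - \<eta>"
        using reals_Archimedean[of "d - \<eta>"] by (auto simp: inverse_eq_divide)
      then have "hits (d - 1 / (n + 1)) x \<subseteq> hits \<eta> x"
        using \<eta> by (intro hits_antimono) auto
      then have "norm_bounded N (hits (d - 1 / (n + 1)) x)"
        using \<eta>(2) unfolding norm_bounded_def by blast
      with lower[of n] n \<eta> show False by (simp add: add.commute)
    qed
  qed
qed

lemma AE_critical_exponent: "AE x in \<mu>. critical_exponent G H N A x = ereal d"
proof -
  \<comment> \<open>The exceptional null set depends on the exponent; restricting to a sequence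
    leaves only countably many to discard.\<close>
  have "AE x in \<mu>. \<forall>n::nat. 0 \<le> d - 1 / (n + 1) \<longrightarrow> \<not> norm_bounded N (hits (d - 1 / (n + 1)) x)"
    unfolding AE_all_countable using hits_unbounded by (auto intro!: AE_impI)
  moreover have "AE x in \<mu>. \<forall>n::nat. norm_bounded N (hits (d + 1 / (n + 1)) x)"
    unfolding AE_all_countable by (intro allI hits_bounded) simp
  ultimately show ?thesis
    by eventually_elim (rule critical_exponent_eq; blast)
qed

end

theorem corollary1p1:
  fixes G :: "('a, 'r) monoid_scheme" and T :: "'a topology"
    and \<Gamma> H :: "'a set" and m :: "'a measure" and \<mu> :: "'a set measure"
    and N :: "'a \<Rightarrow> real" and d :: real and A :: "real \<Rightarrow> 'a set set"
  assumes "locally_compact_group G T"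
    and "lattice_in G T \<Gamma>"
    and "invariant_probability G T \<Gamma> \<mu>"
    and "subgroup H G"
    and "locally_compact_group (subgrp G H) (subtopology T H)"
    and "unimodular (subgrp G H) (subtopology T H)"
    and "haar_measure (subgrp G H) (subtopology T H) m"
    and "acts_ergodically G H \<mu>"
    and "group_norm (subgrp G H) (subtopology T H) N"
    and "growth_exponents H N m d d"
    and "tempered G H N m \<mu>"
    and "shrinking_targets \<mu> A"
    and "stable_under_perturbations G H N \<mu> A"
  shows "AE x in \<mu>. critical_exponent G H N A x = ereal d"
proof -
  interpret tempered_targets G T \<Gamma> H m \<mu> N d A
    using assms by (intro tempered_targets.intro) (simp_all add: lattice_in_def)
  show ?thesis
    by (rule AE_critical_exponent)
qed

end
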